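(* Let $1 \le k \le n$ be integers and let $\mathbb{F}$ be a field with algebraic closure $\overline{\mathbb{F}}$. Let $A$ be a $k \times n$ matrix with entries in $\mathbb{F}$ which is $k$-regular, and let $d_1 > d_2 > \cdots > d_n \ge 1$ be integers. For $i \in [k]$ define $f_i \in \mathbb{F}[x_1,\ldots,x_n]$ by $$f_i(x_1,\ldots,x_n) := \sum_{j=1}^n A_{i,j}\, x_j^{d_j}.$$ Then $\mathbf{V} = \mathbf{V}(f_1,\ldots,f_k)$ is everywhere-finite. In particular, for every $k$-dimensional affine subspace $H \subset \overline{\mathbb{F}}^n$ we have $|\mathbf{V} \cap H| \le d_1^k$.
   Context: A $k \times n$ matrix ($k \le n$) is $k$-regular if all its $k \times k$ minors are nonzero (every $k\times k$ submatrix is invertible). $\mathbf{V}(f_1,\ldots,f_k) := \{x \in \overline{\mathbb{F}}^n : f_1(x)=\cdots=f_k(x)=0\}$. The variety $\mathbf{V}(f_1,\ldots,f_k)$ is called everywhere-finite if for every affine subspace $H \subset \overline{\mathbb{F}}^n$ of dimension $k$, the intersection $\mathbf{V}(f_1,\ldots,f_k)\cap H$ is finite. *)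

theory Defs
  imports
    "HOL-Analysis.Analysis"
    "HOL-Algebra.Algebraic_Closure_Type"
    "HOL-Library.Poly_Mapping"
begin

text \<open>
  Multivariate polynomials with coefficients in \<open>'a\<close> and variables indexed by \<open>'n\<close>:
  finitely supported maps from exponent vectors to coefficients.
\<close>
type_synonym ('n, 'a) mpoly = "('n \<Rightarrow>\<^sub>0 nat) \<Rightarrow>\<^sub>0 'a"

text \<open>The term \<open>c x\<^sub>j\<^sup>e\<close>.\<close>
definition pow_term :: "'a::zero \<Rightarrow> 'n \<Rightarrow> nat \<Rightarrow> ('n, 'a) mpoly" where
  "pow_term c j e = Poly_Mapping.single (Poly_Mapping.single j e) c"

definition eval_ac ::
    "('n::finite, 'a::field) mpoly \<Rightarrow> 'a alg_closure ^ 'n \<Rightarrow> 'a alg_closure" where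
  "eval_ac p x =
     (\<Sum>m\<in>Poly_Mapping.keys p. to_ac (Poly_Mapping.lookup p m) *
        (\<Prod>j\<in>UNIV. (x $ j) ^ Poly_Mapping.lookup m j))"

definition zero_locus ::
    "('k \<Rightarrow> ('n::finite, 'a::field) mpoly) \<Rightarrow> ('a alg_closure ^ 'n) set" where
  "zero_locus f = {x. \<forall>i. eval_ac (f i) x = 0}"

definition affine_subspace_of_dim :: "nat \<Rightarrow> ('b::field ^ 'n::finite) set \<Rightarrow> bool" where
  "affine_subspace_of_dim k H \<longleftrightarrow>
     (\<exists>p W. vec.subspace W \<and> vec.dim W = k \<and> H = (\<lambda>w. p + w) ` W)"

text \<open>The dimension of the affine subspaces is the number of polynomials.\<close>
definition everywhere_finite ::
    "('k::finite \<Rightarrow> ('n::finite, 'a::field) mpoly) \<Rightarrow> bool" where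
  "everywhere_finite f \<longleftrightarrow>
     (\<forall>H. affine_subspace_of_dim CARD('k) H \<longrightarrow> finite (zero_locus f \<inter> H))"

text \<open>
  A choice of \<open>k\<close> distinct columns is an injection \<open>c\<close>; the order in which they are listed
  only affects the sign of the minor.
\<close>
definition k_regular :: "'a::field ^ 'n::finite ^ 'k::finite \<Rightarrow> bool" where
  "k_regular A \<longleftrightarrow> (\<forall>c :: 'k \<Rightarrow> 'n. inj c \<longrightarrow> det (\<chi> i j. A $ i $ c j) \<noteq> 0)"

end

theory Submission
  imports Defs
begin

text \<open>
  Choose greedily, in the order of the variables, \<open>k\<close> pivot coordinates on which every other
  coordinate of the affine subspace \<open>H\<close> depends affinely, each one only through pivots preceding it.
  By regularity the equations can be solved for the powers \<open>y\<^sub>m ^ e\<^sub>m\<close> of the pivots. Give \<open>y\<^sub>m\<close>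
  weight \<open>1 / e\<^sub>m\<close>. A non-pivot \<open>x\<^sub>j\<close> involves only pivots with \<open>e\<^sub>m > d\<^sub>j\<close>, so \<open>x\<^sub>j ^ d\<^sub>j\<close> has weight
  below 1: each \<open>y\<^sub>m ^ e\<^sub>m\<close> is expressed by terms of smaller weight. Hence on a finite set \<open>S\<close> of common
  zeros in \<open>H\<close> all polynomial functions, and so all functions, are combinations of the monomials with
  \<open>y\<^sub>m\<close>-exponents below \<open>e\<^sub>m\<close>, and \<open>card S \<le> (\<Prod>m. e\<^sub>m)\<close>. The spanning statement is used in dual
  form: a functional killing the reduced monomials is zero.
\<close>

no_notation fps_nth (infixl \<open>$\<close> 75)

section \<open>Functions of bounded weighted degree\<close>

text \<open>Polynomials in the \<open>y m\<close> are taken as functions of the point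
  \<open>s\<close>, so \<open>D\<close> bounds the weight of some expression as a sum of monomials;
  no canonical expression is chosen.\<close>

inductive wdeg_le ::
    "('m::finite \<Rightarrow> 's \<Rightarrow> 'b::comm_ring_1) \<Rightarrow> ('m \<Rightarrow> nat) \<Rightarrow> nat \<Rightarrow> ('s \<Rightarrow> 'b) \<Rightarrow> bool"
  for y w D where
  monom: "(\<Sum>m\<in>UNIV. w m * a m) \<le> D \<Longrightarrow> wdeg_le y w D (\<lambda>s. c * (\<Prod>m\<in>UNIV. y m s ^ a m))"
| add: "wdeg_le y w D g \<Longrightarrow> wdeg_le y w D h \<Longrightarrow> wdeg_le y w D (\<lambda>s. g s + h s)"

lemma wdeg_le_const: "wdeg_le y w D (\<lambda>_. c)"
  using wdeg_le.monom[of w "\<lambda>_. 0" D y c] by simp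

lemma wdeg_le_var:
  assumes "w m \<le> D"
  shows "wdeg_le y w D (y m)"
proof -
  have "(\<Sum>k\<in>UNIV. w k * (if k = m then 1 else 0)) = w m"
    by (simp add: if_distrib cong: if_cong)
  moreover have "(\<Prod>k\<in>UNIV. y k s ^ (if k = m then 1 else 0)) = y m s" for s
    by (subst prod.remove[of _ m]) auto
  ultimately show ?thesis
    using wdeg_le.monom[of w "\<lambda>k. if k = m then 1 else 0" D y 1] assms by simp
qed

lemma wdeg_le_mult:
  assumes "wdeg_le y w D g" "wdeg_le y w D' h"
  shows "wdeg_le y w (D + D') (\<lambda>s. g s * h s)"
  using assms(1)
proof induction
  case (monom a c)
  show ?case
    using assms(2)
  proof induction
    case (monom a' c')
    have "(\<Sum>m\<in>UNIV. w m * (a m + a' m)) \<le> D + D'"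
      using \<open>(\<Sum>m\<in>UNIV. w m * a m) \<le> D\<close> monom by (simp add: distrib_left sum.distrib)
    from wdeg_le.monom[OF this, of y "c * c'"] show ?case
      by (simp add: power_add prod.distrib mult_ac)
  next
    case (add g h)
    then show ?case by (simp add: distrib_left wdeg_le.add)
  qed
next
  case (add g1 g2)
  then show ?case by (simp add: distrib_right wdeg_le.add)
qed

lemma wdeg_le_cmult: "wdeg_le y w D g \<Longrightarrow> wdeg_le y w D (\<lambda>s. c * g s)"
  using wdeg_le_mult[OF wdeg_le_const[of y w 0 c]] by fastforce

lemma wdeg_le_mono: "wdeg_le y w D g \<Longrightarrow> D \<le> D' \<Longrightarrow> wdeg_le y w D' g"
  using wdeg_le_mult[OF wdeg_le_const[of y w "D' - D" 1]] by fastforce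

lemma wdeg_le_power: "wdeg_le y w D g \<Longrightarrow> wdeg_le y w (n * D) (\<lambda>s. g s ^ n)"
  by (induction n) (simp_all add: wdeg_le_const wdeg_le_mult)

lemma wdeg_le_sum:
  assumes "finite J" "\<And>j. j \<in> J \<Longrightarrow> wdeg_le y w D (g j)"
  shows "wdeg_le y w D (\<lambda>s. \<Sum>j\<in>J. g j s)"
  using assms by (induction J rule: finite_induct) (simp_all add: wdeg_le_const wdeg_le.add)

lemma wdeg_le_prod:
  assumes "finite J" "\<And>j. j \<in> J \<Longrightarrow> \<exists>D. wdeg_le y w D (g j)"
  shows "\<exists>D. wdeg_le y w D (\<lambda>s. \<Prod>j\<in>J. g j s)"
  using assms
proof (induction J rule: finite_induct)
  case empty
  show ?case using wdeg_le_const[of y w 0 1] by auto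
next
  case (insert j J)
  then obtain D D' where "wdeg_le y w D (g j)" "wdeg_le y w D' (\<lambda>s. \<Prod>j\<in>J. g j s)"
    by (meson insertI1 insertI2)
  from wdeg_le_mult[OF this] show ?case using insert by auto
qed

section \<open>Counting points by reduced monomials\<close>

text \<open>Gaussian elimination: an equation with a nonzero coefficient is removed together with
  one unknown, and a zero equation is dropped.\<close>

lemma homogeneous_system_nontrivial_solution:
  fixes M :: "'i \<Rightarrow> 's \<Rightarrow> 'b::field"
  assumes "finite I" "finite S" "card I < card S"
  shows "\<exists>\<phi>. (\<exists>s\<in>S. \<phi> s \<noteq> 0) \<and> (\<forall>i\<in>I. (\<Sum>s\<in>S. \<phi> s * M i s) = 0)"
  using assms
proof (induction I arbitrary: S M rule: finite_induct)
  case empty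
  then have "S \<noteq> {}" by auto
  then show ?case by (intro exI[of _ "\<lambda>_. 1"]) auto
next
  case (insert i I)
  show ?case
  proof (cases "\<forall>s\<in>S. M i s = 0")
    case True
    from insert have "card I < card S" by simp
    from insert.IH[OF insert.prems(1) this, of M] True show ?thesis by auto
  next
    case False
    then obtain t where t: "t \<in> S" "M i t \<noteq> 0" by auto
    define S' where "S' = S - {t}"
    have S': "finite S'" "card I < card S'"
      using insert t by (auto simp: S'_def)
    \<comment> \<open>Eliminate the unknown \<open>\<phi> t\<close> by means of equation \<open>i\<close>.\<close>
    define M' where "M' = (\<lambda>j s. M j s - M i s / M i t * M j t)"
    obtain \<phi> where \<phi>: "\<exists>s\<in>S'. \<phi> s \<noteq> 0" "\<And>j. j \<in> I \<Longrightarrow> (\<Sum>s\<in>S'. \<phi> s * M' j s) = 0"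
      using insert.IH[OF S', of M'] by blast
    \<comment> \<open>The value that equation \<open>i\<close> forces on the eliminated
      unknown.\<close>
    define r where "r = - (\<Sum>s\<in>S'. \<phi> s * M i s) / M i t"
    define \<psi> where "\<psi> = \<phi>(t := r)"
    have split: "(\<Sum>s\<in>S. \<psi> s * M j s) = r * M j t + (\<Sum>s\<in>S'. \<phi> s * M j s)" for j
    proof -
      have "(\<Sum>s\<in>S'. \<psi> s * M j s) = (\<Sum>s\<in>S'. \<phi> s * M j s)"
        by (rule sum.cong) (auto simp: \<psi>_def S'_def)
      then show ?thesis
        using sum.remove[OF insert.prems(1) t(1), of "\<lambda>s. \<psi> s * M j s"]
        by (simp add: S'_def \<psi>_def)
    qed
    have "(\<Sum>s\<in>S. \<psi> s * M i s) = 0"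
      unfolding split using t by (simp add: r_def)
    moreover have "(\<Sum>s\<in>S. \<psi> s * M j s) = 0" if "j \<in> I" for j
    proof -
      have "(\<Sum>s\<in>S'. \<phi> s * M' j s)
          = (\<Sum>s\<in>S'. \<phi> s * M j s) - (\<Sum>s\<in>S'. \<phi> s * M i s) / M i t * M j t"
        by (simp add: M'_def sum_subtractf right_diff_distrib sum_distrib_right sum_divide_distrib mult.assoc)
      then show ?thesis
        using \<phi>(2)[OF that] by (simp add: split r_def)
    qed
    moreover have "\<exists>s\<in>S. \<psi> s \<noteq> 0"
      using \<phi>(1) by (auto simp: \<psi>_def S'_def)
    ultimately show ?thesis by blast
  qed
qed

text \<open>Induction on the weight of a monomial. All \<open>y m ^ e m\<close> have weight
  \<open>E\<close>, and \<open>E - 1\<close> encodes a strictly smaller weight: a non-reduced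
  monomial contains some \<open>y m ^ e m\<close>, and replacing it by \<open>g\<close> lowers the
  weight.\<close>

lemma functional_vanishes_of_reduced:
  fixes y :: "'m::finite \<Rightarrow> 's \<Rightarrow> 'b::field"
  assumes E: "E > 0" "\<And>m. w m * e m = E"
    and rel: "\<And>m. \<exists>g. wdeg_le y w (E - 1) g \<and> (\<forall>s\<in>S. y m s ^ e m = g s)"
    and red: "\<And>a. (\<forall>m. a m < e m) \<Longrightarrow> (\<Sum>s\<in>S. \<phi> s * (\<Prod>m\<in>UNIV. y m s ^ a m)) = 0"
    and h: "wdeg_le y w D h"
  shows "(\<Sum>s\<in>S. \<phi> s * h s) = 0"
proof -
  define wt where "wt a = (\<Sum>m\<in>UNIV. w m * a m)" for a
  \<comment> \<open>Vanishing on monomials is assumed only up to weight \<open>D\<close>, so that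
    this also applies inside the induction, where only lighter monomials are known to be
    killed.\<close>
  have lin: "(\<Sum>s\<in>S. \<phi> s * h s) = 0"
    if mon: "\<And>a. wt a \<le> D \<Longrightarrow> (\<Sum>s\<in>S. \<phi> s * (\<Prod>m\<in>UNIV. y m s ^ a m)) = 0"
      and "wdeg_le y w D h" for D h
    using that(2)
  proof induction
    case (monom a c)
    have "(\<Sum>s\<in>S. \<phi> s * (c * (\<Prod>m\<in>UNIV. y m s ^ a m)))
        = c * (\<Sum>s\<in>S. \<phi> s * (\<Prod>m\<in>UNIV. y m s ^ a m))"
      by (simp add: sum_distrib_left mult_ac)
    then show ?case using monom mon[of a] by (simp add: wt_def)
  next
    case (add g h)
    then show ?case by (simp add: distrib_left sum.distrib)
  qed
  have "(\<Sum>s\<in>S. \<phi> s * (\<Prod>m\<in>UNIV. y m s ^ a m)) = 0" for a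
  proof (induction "wt a" arbitrary: a rule: less_induct)
    case less
    show ?case
    proof (cases "\<forall>m. a m < e m")
      case True
      then show ?thesis by (rule red)
    next
      case False
      then obtain m where m: "e m \<le> a m" by (auto simp: not_less)
      obtain g where g: "wdeg_le y w (E - 1) g" "\<And>s. s \<in> S \<Longrightarrow> y m s ^ e m = g s"
        using rel by blast
      define a' where "a' = a(m := a m - e m)"
      have "w m * a m = w m * a' m + E"
        using m by (simp add: a'_def flip: distrib_left E(2)[of m])
      moreover have "(\<Sum>k\<in>UNIV - {m}. w k * a k) = (\<Sum>k\<in>UNIV - {m}. w k * a' k)"
        by (rule sum.cong) (auto simp: a'_def)
      ultimately have wt: "wt a = wt a' + E"
        unfolding wt_def sum.remove[OF finite UNIV_I, of "\<lambda>k. w k * a k" m]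
          sum.remove[OF finite UNIV_I, of "\<lambda>k. w k * a' k" m] by simp
      have prod: "(\<Prod>k\<in>UNIV. y k s ^ a k) = (\<Prod>k\<in>UNIV. y k s ^ a' k) * g s" if "s \<in> S" for s
      proof -
        have "y m s ^ a m = y m s ^ a' m * g s"
          using m by (simp add: a'_def flip: g(2)[OF that] power_add)
        moreover have "(\<Prod>k\<in>UNIV - {m}. y k s ^ a k) = (\<Prod>k\<in>UNIV - {m}. y k s ^ a' k)"
          by (rule prod.cong) (auto simp: a'_def)
        ultimately show ?thesis
          unfolding prod.remove[OF finite UNIV_I, of "\<lambda>k. y k s ^ a k" m]
            prod.remove[OF finite UNIV_I, of "\<lambda>k. y k s ^ a' k" m] by (simp add: mult_ac)
      qed
      have "wdeg_le y w (wt a') (\<lambda>s. 1 * (\<Prod>k\<in>UNIV. y k s ^ a' k))"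
        unfolding wt_def by (rule wdeg_le.monom) simp
      \<comment> \<open>This bound is \<open>wt a - 1\<close>, so the induction hypothesis covers
        every monomial involved.\<close>
      from wdeg_le_mult[OF this g(1)]
      have "wdeg_le y w (wt a' + (E - 1)) (\<lambda>s. (\<Prod>k\<in>UNIV. y k s ^ a' k) * g s)"
        by simp
      then have "(\<Sum>s\<in>S. \<phi> s * ((\<Prod>k\<in>UNIV. y k s ^ a' k) * g s)) = 0"
      proof (rule lin[rotated])
        fix b assume "wt b \<le> wt a' + (E - 1)"
        then have "wt b < wt a" using wt E(1) by linarith
        then show "(\<Sum>s\<in>S. \<phi> s * (\<Prod>k\<in>UNIV. y k s ^ b k)) = 0" by (rule less.hyps)
      qed
      then show ?thesis by (simp add: prod cong: sum.cong)
    qed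
  qed
  then show ?thesis using lin h by blast
qed

text \<open>With more points than reduced monomials, some nonzero functional kills all reduced
  monomials, hence all polynomials, including one that is nonzero at exactly one point of
  \<open>S\<close>.\<close>

lemma card_le_prod_of_weighted_relations:
  fixes y :: "'m::finite \<Rightarrow> 's \<Rightarrow> 'b::field"
  assumes S: "finite S"
    and E: "E > 0" "\<And>m. w m * e m = E"
    and rel: "\<And>m. \<exists>g. wdeg_le y w (E - 1) g \<and> (\<forall>s\<in>S. y m s ^ e m = g s)"
    and sep: "\<And>s t. s \<in> S \<Longrightarrow> t \<in> S \<Longrightarrow> s \<noteq> t \<Longrightarrow> \<exists>m. y m s \<noteq> y m t"
  shows "card S \<le> (\<Prod>m\<in>UNIV. e m)"
proof (rule ccontr)
  assume "\<not> ?thesis"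
  define I where "I = PiE UNIV (\<lambda>m. {..<e m})"
  have "finite I" "card I = (\<Prod>m\<in>UNIV. e m)"
    unfolding I_def by (auto simp: card_PiE intro!: finite_PiE)
  with \<open>\<not> ?thesis\<close> have "finite I" "card I < card S" by auto
  then obtain \<phi> t where t: "t \<in> S" "\<phi> t \<noteq> 0"
    and \<phi>: "\<And>a. a \<in> I \<Longrightarrow> (\<Sum>s\<in>S. \<phi> s * (\<Prod>m\<in>UNIV. y m s ^ a m)) = 0"
    using homogeneous_system_nontrivial_solution[of I S "\<lambda>a s. \<Prod>m\<in>UNIV. y m s ^ a m"] S by blast
  obtain m where m: "\<And>s. s \<in> S - {t} \<Longrightarrow> y (m s) s \<noteq> y (m s) t"
    using sep t(1) by (metis DiffE insertI1)
  \<comment> \<open>Factors of an interpolation polynomial: their product over \<open>u\<close>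
    vanishes on \<open>S - {t}\<close> but not at \<open>t\<close>, so the functional would return a
    nonzero multiple of \<open>\<phi> t\<close>.\<close>
  have "wdeg_le y w (w (m u)) (\<lambda>s. y (m u) s + (- y (m u) u))" for u
    by (intro wdeg_le.add wdeg_le_var wdeg_le_const) simp
  then have "\<exists>D. wdeg_le y w D (\<lambda>s. \<Prod>u\<in>S - {t}. y (m u) s + (- y (m u) u))"
    using S by (intro wdeg_le_prod) auto
  then obtain D where "wdeg_le y w D (\<lambda>s. \<Prod>u\<in>S - {t}. y (m u) s + (- y (m u) u))"
    by blast
  then have "(\<Sum>s\<in>S. \<phi> s * (\<Prod>u\<in>S - {t}. y (m u) s + (- y (m u) u))) = 0"
    by (rule functional_vanishes_of_reduced[OF E rel, rotated]) (simp add: \<phi> I_def PiE_def Pi_def)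
  moreover have "(\<Prod>u\<in>S - {t}. y (m u) s + (- y (m u) u)) = 0" if "s \<in> S - {t}" for s
    using S that by (intro prod_zero) auto
  ultimately have "\<phi> t * (\<Prod>u\<in>S - {t}. y (m u) t + (- y (m u) u)) = 0"
    using sum.remove[OF S t(1), of "\<lambda>s. \<phi> s * (\<Prod>u\<in>S - {t}. y (m u) s + (- y (m u) u))"] by simp
  moreover have "(\<Prod>u\<in>S - {t}. y (m u) t + (- y (m u) u)) \<noteq> 0"
    using S m by (fastforce simp: prod_zero_iff)
  ultimately show False using t(2) by simp
qed

section \<open>Pivot coordinates of an affine subspace\<close>

text \<open>Pivots are added in increasing order; each avoids the span of all earlier vectors, in
  particular that of the earlier pivots.\<close>

lemma independent_greedy_pivots:
  fixes r :: "'n::linorder \<Rightarrow> 'b::field ^ 'k::finite"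
  assumes "finite P" "\<And>j. j \<in> P \<Longrightarrow> r j \<notin> vec.span (r ` {i. i < j})"
  shows "vec.independent (r ` P) \<and> inj_on r P"
  using assms
proof (induction P rule: finite_linorder_max_induct)
  case empty
  then show ?case by (simp add: vec.independent_empty)
next
  case (insert b P)
  have "vec.span (r ` P) \<subseteq> vec.span (r ` {i. i < b})"
    using insert by (intro vec.span_mono) auto
  then have "r b \<notin> vec.span (r ` P)"
    using insert by auto
  moreover from this have "r b \<notin> r ` P"
    by (rule contra_subsetD[OF vec.span_superset])
  ultimately show ?case
    using insert vec.independent_insertI[of "r b" "r ` P"] by auto
qed

text \<open>Induction along the order: a non-pivot is a combination of earlier vectors, which are
  already combinations of pivots.\<close>

lemma span_greedy_pivots:
  fixes r :: "'n::{finite,linorder} \<Rightarrow> 'b::field ^ 'k::finite"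
  defines "P \<equiv> {j. r j \<notin> vec.span (r ` {i. i < j})}"
  shows "r j \<in> vec.span (r ` {i\<in>P. i \<le> j})"
proof (induction "card {i. i < j}" arbitrary: j rule: less_induct)
  case less
  show ?case
  proof (cases "j \<in> P")
    case True
    then show ?thesis by (auto intro: vec.span_base)
  next
    case False
    then have "r j \<in> vec.span (r ` {i. i < j})" by (simp add: P_def)
    moreover have "r ` {i. i < j} \<subseteq> vec.span (r ` {i\<in>P. i \<le> j})"
    proof safe
      fix i assume "i < j"
      then have "{k. k < i} \<subset> {k. k < j}" by auto
      then have "r i \<in> vec.span (r ` {k\<in>P. k \<le> i})"
        by (intro less psubset_card_mono) auto
      also have "\<dots> \<subseteq> vec.span (r ` {k\<in>P. k \<le> j})"
        using \<open>i < j\<close> by (intro vec.span_mono) auto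
      finally show "r i \<in> \<dots>" .
    qed
    ultimately show ?thesis
      using vec.span_minimal vec.subspace_span by blast
  qed
qed

text \<open>
  There are at most \<open>CARD('k)\<close> greedy pivots. If there are fewer, arbitrary further coordinates are
  declared pivots.
\<close>

lemma exists_pivots:
  fixes r :: "'n::{finite,linorder} \<Rightarrow> 'b::field ^ 'k::finite"
  assumes "CARD('k) \<le> CARD('n)"
  obtains c :: "'k \<Rightarrow> 'n" where "inj c"
    "\<And>j. j \<notin> range c \<Longrightarrow> r j \<in> vec.span (r ` {i\<in>range c. i < j})"
proof -
  define P where "P = {j. r j \<notin> vec.span (r ` {i. i < j})}"
  have "vec.independent (r ` P) \<and> inj_on r P"
    by (rule independent_greedy_pivots) (simp_all add: P_def)
  then have ind: "vec.independent (r ` P)" "inj_on r P" by simp_all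
  then have "card P \<le> CARD('k)"
    using vec.independent_card_le_dim[of "r ` P" UNIV] by (simp add: card_image card_cart_basis)
  then obtain Q where Q: "P \<subseteq> Q" "card Q = CARD('k)"
    using assms exists_subset_between[of P "CARD('k)" UNIV] by auto
  then obtain c where c: "bij_betw c (UNIV :: 'k set) Q"
    using finite_same_card_bij[of "UNIV :: 'k set" Q] by auto
  have ran: "range c = Q" "inj c"
    using c by (auto simp: bij_betw_def)
  have "r j \<in> vec.span (r ` {i\<in>Q. i < j})" if "j \<notin> Q" for j
  proof -
    \<comment> \<open>As \<open>j\<close> is outside \<open>Q\<close>, the bound becomes strict;
      this later yields \<open>e m > d j\<close> for the pivots involved.\<close>
    have "{i\<in>P. i \<le> j} \<subseteq> {i\<in>Q. i < j}"
      using Q that by (auto simp: order_le_less)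
    then show ?thesis
      using span_greedy_pivots[of r j] vec.span_mono[OF image_mono, of _ _ r]
      unfolding P_def by blast
  qed
  then show ?thesis using that[of c] ran by simp
qed

text \<open>\<open>r j\<close> collects the \<open>j\<close>-th coordinates of a basis, so linear
  relations among the vectors \<open>r j\<close> become relations among the coordinate functions on
  \<open>W\<close>.\<close>

lemma subspace_parametrization:
  fixes W :: "('b::field ^ 'n::finite) set"
  assumes "vec.subspace W" "vec.dim W = CARD('k::finite)"
  obtains r :: "'n \<Rightarrow> 'b ^ 'k" where
    "\<And>x. x \<in> W \<Longrightarrow> \<exists>t. \<forall>j. x $ j = (\<Sum>m\<in>UNIV. t $ m * r j $ m)"
proof -
  obtain B where B: "B \<subseteq> W" "vec.independent B" "W \<subseteq> vec.span B" "card B = CARD('k)"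
    using vec.basis_exists[of W] assms(2) by metis
  have "finite B" using B(4) by (intro card_ge_0_finite) simp
  then obtain b where b: "bij_betw b (UNIV :: 'k set) B"
    using B(4) finite_same_card_bij[of "UNIV :: 'k set" B] by auto
  show ?thesis
  proof (rule that[of "\<lambda>j. \<chi> m. b m $ j"])
    fix x assume "x \<in> W"
    then obtain u where "x = (\<Sum>v\<in>B. u v *s v)"
      using B(3) \<open>finite B\<close> by (auto simp: vec.span_finite)
    also have "\<dots> = (\<Sum>m\<in>UNIV. u (b m) *s b m)"
      by (rule sum.reindex_bij_betw[OF b, symmetric])
    finally show "\<exists>t. \<forall>j. x $ j = (\<Sum>m\<in>UNIV. t $ m * (\<chi> m. b m $ j) $ m)"
      by (intro exI[of _ "\<chi> m. u (b m)"]) simp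
  qed
qed

section \<open>Evaluation of polynomials\<close>

lemma eval_ac_superset:
  assumes "finite M" "Poly_Mapping.keys p \<subseteq> M"
  shows "eval_ac p x = (\<Sum>m\<in>M. to_ac (Poly_Mapping.lookup p m) *
        (\<Prod>j\<in>UNIV. (x $ j) ^ Poly_Mapping.lookup m j))"
  unfolding eval_ac_def
  by (rule sum.mono_neutral_left) (use assms in \<open>auto simp: in_keys_iff\<close>)

lemma eval_ac_add: "eval_ac (p + q) x = eval_ac p x + eval_ac q x"
proof -
  define M where "M = Poly_Mapping.keys p \<union> Poly_Mapping.keys q"
  have M: "finite M" "Poly_Mapping.keys p \<subseteq> M" "Poly_Mapping.keys q \<subseteq> M"
    "Poly_Mapping.keys (p + q) \<subseteq> M"
    using Poly_Mapping.keys_add[of p q] by (auto simp: M_def)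
  show ?thesis
    unfolding eval_ac_superset[OF M(1,2)] eval_ac_superset[OF M(1,3)] eval_ac_superset[OF M(1,4)]
    by (simp add: lookup_add sum.distrib distrib_right)
qed

lemma eval_ac_sum: "eval_ac (\<Sum>j\<in>J. p j) x = (\<Sum>j\<in>J. eval_ac (p j) x)"
proof (induction J rule: infinite_finite_induct)
  case (insert j J)
  then show ?case by (simp add: eval_ac_add)
qed (simp_all add: eval_ac_def)

lemma eval_ac_pow_term: "eval_ac (pow_term c j e) x = to_ac c * (x $ j) ^ e"
proof -
  have "(\<Prod>i\<in>UNIV. (x $ i) ^ Poly_Mapping.lookup (Poly_Mapping.single j e) i) = (x $ j) ^ e"
    by (subst prod.remove[of _ j]) (auto simp: lookup_single when_def)
  then show ?thesis
    using eval_ac_superset[of "{Poly_Mapping.single j e}" "pow_term c j e" x]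
    by (simp add: pow_term_def)
qed

section \<open>The bound for finite sets of common zeros\<close>

text \<open>Regularity enters as a left inverse of the chosen columns, the form in which it solves
  the equations for the pivot powers.\<close>

lemma zero_locus_affine_bound:
  fixes A :: "'b::field ^ 'n::{finite,linorder} ^ 'k::finite"
  assumes le: "CARD('k) \<le> CARD('n)"
    and reg: "\<And>c :: 'k \<Rightarrow> 'n. inj c \<Longrightarrow> \<exists>B. \<forall>m l. (\<Sum>i\<in>UNIV. B m i * A $ i $ c l) = (if m = l then 1 else 0)"
    and dec: "\<And>i j. i < j \<Longrightarrow> d i > d j"
    and pos: "\<And>j. d j \<ge> 1"
    and H: "affine_subspace_of_dim CARD('k) H"
    and S: "finite S" "S \<subseteq> H" "\<And>x i. x \<in> S \<Longrightarrow> (\<Sum>j\<in>UNIV. A $ i $ j * (x $ j) ^ d j) = 0"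
  shows "card S \<le> d (Min UNIV) ^ CARD('k)"
proof -
  obtain p W where W: "vec.subspace W" "vec.dim W = CARD('k)" "H = (\<lambda>w. p + w) ` W"
    using H by (auto simp: affine_subspace_of_dim_def)
  obtain r :: "'n \<Rightarrow> 'b ^ 'k"
    where r: "\<And>x. x \<in> W \<Longrightarrow> \<exists>t. \<forall>j. x $ j = (\<Sum>m\<in>UNIV. t $ m * r j $ m)"
    using subspace_parametrization[OF W(1,2)] by metis
  have "\<exists>t. \<forall>j. x $ j = p $ j + (\<Sum>m\<in>UNIV. t $ m * r j $ m)" if x: "x \<in> S" for x
  proof -
    obtain v where v: "v \<in> W" "x = p + v" using x S(2) unfolding W(3) by auto
    show ?thesis using r[OF v(1)] by (simp add: v(2))
  qed
  then obtain t where t: "\<And>x j. x \<in> S \<Longrightarrow> x $ j = p $ j + (\<Sum>m\<in>UNIV. t x $ m * r j $ m)"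
    by metis
  obtain c :: "'k \<Rightarrow> 'n" where c: "inj c"
    "\<And>j. j \<notin> range c \<Longrightarrow> r j \<in> vec.span (r ` {i\<in>range c. i < j})"
    using exists_pivots[OF le, of r] by blast
  obtain B where B: "\<And>m l. (\<Sum>i\<in>UNIV. B m i * A $ i $ c l) = (if m = l then 1 else 0)"
    using reg[OF c(1)] by metis
  \<comment> \<open>\<open>t\<close> is specified only on \<open>S\<close>. Defining
    \<open>y\<close> and \<open>z\<close> through \<open>t\<close> makes the affine dependences hold
    as identities of functions, as \<open>wdeg_le\<close> requires; on \<open>S\<close> they are the
    coordinates.\<close>
  define y where "y m x = p $ c m + (\<Sum>l\<in>UNIV. t x $ l * r (c m) $ l)" for m x
  have y: "y m x = x $ c m" if "x \<in> S" for m x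
    using t[OF that] by (simp add: y_def)
  define z where "z j x = p $ j + (\<Sum>l\<in>UNIV. t x $ l * r j $ l)" for j x
  have z: "z j x = x $ j" if "x \<in> S" for j x
    using t[OF that] by (simp add: z_def)
  define e where "e m = d (c m)" for m
  \<comment> \<open>The weights \<open>1 / e m\<close> are scaled by \<open>E\<close> to become integers.\<close>
  define E where "E = (\<Prod>m\<in>UNIV. e m)"
  define w where "w m = E div e m" for m
  have e: "e m \<ge> 1" for m using pos by (simp add: e_def)
  have wE: "w m * e m = E" for m
    unfolding w_def E_def by (intro dvd_div_mult_self dvd_prodI) auto
  have "E > 0" unfolding E_def using e by (intro prod_pos) (auto simp: Suc_le_eq)
  \<comment> \<open>A linear form from this span is a combination of the
    \<open>y m - p $ c m\<close> with \<open>c m < j\<close>.\<close>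
  have span: "wdeg_le y w D (\<lambda>x. \<Sum>l\<in>UNIV. t x $ l * v $ l)"
    if v: "v \<in> vec.span (r ` {i\<in>range c. i < j})" and D: "\<And>m. c m < j \<Longrightarrow> w m \<le> D" for v j D
    using v
  proof (induction rule: vec.span_induct_alt)
    case base
    show ?case by (simp add: wdeg_le_const)
  next
    case (step a u v)
    then obtain m where m: "c m < j" "u = r (c m)" by auto
    have "wdeg_le y w D (\<lambda>x. a * (y m x + - p $ c m) + (\<Sum>l\<in>UNIV. t x $ l * v $ l))"
      using D[OF m(1)] step by (intro wdeg_le.add wdeg_le_cmult wdeg_le_var wdeg_le_const)
    then show ?case
      by (simp add: y_def[of m] m(2) distrib_left sum.distrib sum_distrib_left mult_ac)
  qed
  have nonpivot: "wdeg_le y w (E - 1) (\<lambda>x. z j x ^ d j)" if j: "j \<notin> range c" for j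
  proof -
    \<comment> \<open>The largest \<open>D\<close> with \<open>d j * D \<le> E - 1\<close>. For
      \<open>c m < j\<close>, \<open>d j < e m\<close> gives \<open>w m * d j < E\<close>, hence
      \<open>w m \<le> D\<close>.\<close>
    define D where "D = (E - 1) div d j"
    have "w m \<le> D" if "c m < j" for m
    proof -
      have "w m > 0" using wE[of m] \<open>E > 0\<close> by (cases "w m") auto
      then have "w m * d j < w m * e m" using dec[OF that] by (simp add: e_def)
      then show ?thesis
        unfolding D_def using pos[of j] wE[of m] by (simp add: less_eq_div_iff_mult_less_eq)
    qed
    then have "wdeg_le y w D (z j)"
      unfolding z_def using span[OF c(2)[OF j]] by (intro wdeg_le.add wdeg_le_const) auto
    then have "wdeg_le y w (d j * D) (\<lambda>x. z j x ^ d j)" by (rule wdeg_le_power)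
    then show ?thesis by (rule wdeg_le_mono) (simp add: D_def)
  qed
  have rel: "\<exists>g. wdeg_le y w (E - 1) g \<and> (\<forall>x\<in>S. y m x ^ e m = g x)" for m
  proof (intro exI conjI ballI)
    \<comment> \<open>The coefficients of row \<open>m\<close> after multiplying the system by
      \<open>B\<close>; among the pivot columns only that of \<open>c m\<close> survives, with
      coefficient 1.\<close>
    let ?C = "\<lambda>j. \<Sum>i\<in>UNIV. B m i * A $ i $ j"
    show "wdeg_le y w (E - 1) (\<lambda>x. \<Sum>j\<in>- range c. - ?C j * z j x ^ d j)"
      by (intro wdeg_le_sum wdeg_le_cmult nonpivot) auto
    fix x assume x: "x \<in> S"
    have "0 = (\<Sum>i\<in>UNIV. B m i * (\<Sum>j\<in>UNIV. A $ i $ j * (x $ j) ^ d j))"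
      using S(3)[OF x] by simp
    also have "\<dots> = (\<Sum>j\<in>UNIV. ?C j * (x $ j) ^ d j)"
      unfolding sum_distrib_left sum_distrib_right by (subst sum.swap) (simp add: mult.assoc)
    also have "\<dots> = (\<Sum>j\<in>range c. ?C j * (x $ j) ^ d j) + (\<Sum>j\<in>- range c. ?C j * (x $ j) ^ d j)"
      by (subst sum.union_disjoint[symmetric]) auto
    also have "(\<Sum>j\<in>range c. ?C j * (x $ j) ^ d j) = (\<Sum>l\<in>UNIV. ?C (c l) * (x $ c l) ^ d (c l))"
      using sum.reindex[OF c(1)] by simp
    also have "\<dots> = (x $ c m) ^ d (c m)"
      by (simp add: B if_distrib if_distribR cong: if_cong)
    finally have "(x $ c m) ^ d (c m) = - (\<Sum>j\<in>- range c. ?C j * (x $ j) ^ d j)"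
      unfolding eq_neg_iff_add_eq_0 by (rule sym)
    then show "y m x ^ e m = (\<Sum>j\<in>- range c. - ?C j * z j x ^ d j)"
      by (simp add: x y z e_def sum_negf)
  qed
  \<comment> \<open>The bound \<open>E\<close> is crude: this serves only to show that the pivots
    determine all coordinates and so separate the points of \<open>S\<close>.\<close>
  have coord: "wdeg_le y w E (z j)" for j
  proof (cases "j \<in> range c")
    case True
    then obtain m where "j = c m" by auto
    then have "z j = y m" by (auto simp: z_def y_def)
    moreover have "w m \<le> E" by (simp add: w_def)
    ultimately show ?thesis by (simp add: wdeg_le_var)
  next
    case False
    then show ?thesis
      unfolding z_def using span[OF c(2)]
      by (intro wdeg_le.add wdeg_le_const) (auto simp: w_def)
  qed
  have invar: "g x = g x'" if "wdeg_le y w D g" "\<forall>m. y m x = y m x'" for g D x x'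
    using that by induction simp_all
  have sep: "\<exists>m. y m x \<noteq> y m x'" if "x \<in> S" "x' \<in> S" "x \<noteq> x'" for x x'
    using invar[OF coord] that by (metis z vec_eq_iff)
  have "card S \<le> (\<Prod>m\<in>UNIV. e m)"
    by (rule card_le_prod_of_weighted_relations[OF S(1) \<open>E > 0\<close> wE rel sep])
  also have "\<dots> \<le> (\<Prod>m\<in>(UNIV :: 'k set). d (Min UNIV))"
  proof (rule prod_mono)
    fix m :: 'k
    have "Min UNIV \<le> c m" by simp
    then have "d (c m) \<le> d (Min UNIV)"
      using dec[of "Min UNIV" "c m"] by (cases "Min UNIV = c m") (auto simp: less_le)
    then show "0 \<le> e m \<and> e m \<le> d (Min UNIV)" by (simp add: e_def)
  qed
  finally show ?thesis by simp
qed

section \<open>Passage to the algebraic closure\<close>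

text \<open>The inverse is formed over the base field, and the homomorphism \<open>to_ac\<close>
  carries its defining identities to the closure.\<close>

lemma k_regular_left_inverse_ac:
  fixes A :: "'a::field ^ 'n::finite ^ 'k::finite" and c :: "'k \<Rightarrow> 'n"
  assumes "k_regular A" "inj c"
  shows "\<exists>B. \<forall>m l. (\<Sum>i\<in>UNIV. B m i * to_ac (A $ i $ c l)) = (if m = l then 1 else 0)"
proof -
  let ?C = "(\<chi> i j. A $ i $ c j) :: 'a ^ 'k ^ 'k"
  have "invertible ?C"
    using assms by (simp add: k_regular_def invertible_det_nz)
  then obtain B where B: "B ** ?C = mat 1"
    by (auto simp: invertible_def)
  have "(\<Sum>i\<in>UNIV. to_ac (B $ m $ i) * to_ac (A $ i $ c l)) = (if m = l then 1 else 0)" for m l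
  proof -
    have "(\<Sum>i\<in>UNIV. B $ m $ i * A $ i $ c l) = (if m = l then 1 else 0)"
      using arg_cong[OF B, of "\<lambda>M. M $ m $ l"] by (simp add: matrix_matrix_mult_def mat_def)
    from arg_cong[OF this, of to_ac] show ?thesis
      by (simp add: if_distrib[of to_ac] to_ac_sum)
  qed
  then show ?thesis by (intro exI[of _ "\<lambda>m i. to_ac (B $ m $ i)"]) blast
qed

theorem theorem2p4:
  fixes A :: "'a::field ^ 'n::{finite,linorder} ^ 'k::finite"
    and d :: "'n \<Rightarrow> nat"
    and f :: "'k \<Rightarrow> ('n, 'a) mpoly"
  assumes "CARD('k) \<le> CARD('n)"
    and "k_regular A"
    and "\<forall>i j. i < j \<longrightarrow> d i > d j"
    and "\<forall>j. d j \<ge> 1"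
    and "\<forall>i. f i = (\<Sum>j\<in>UNIV. pow_term (A $ i $ j) j (d j))"
  shows "everywhere_finite f \<and>
    (\<forall>H. affine_subspace_of_dim CARD('k) H \<longrightarrow>
       card (zero_locus f \<inter> H) \<le> d (Min UNIV) ^ CARD('k))"
proof -
  have "finite (zero_locus f \<inter> H) \<and> card (zero_locus f \<inter> H) \<le> d (Min UNIV) ^ CARD('k)"
    if H: "affine_subspace_of_dim CARD('k) H" for H
  \<comment> \<open>A uniform bound on finite subsets gives finiteness as well; \<open>card\<close>
    alone would not, being 0 on infinite sets.\<close>
  proof (rule finite_if_finite_subsets_card_bdd)
    fix S assume S: "S \<subseteq> zero_locus f \<inter> H" "finite S"
    show "card S \<le> d (Min UNIV) ^ CARD('k)"
    proof (rule zero_locus_affine_bound[where A = "\<chi> i j. to_ac (A $ i $ j)" and H = H])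
      show "\<exists>B. \<forall>m l. (\<Sum>i\<in>UNIV. B m i * (\<chi> i j. to_ac (A $ i $ j)) $ i $ c l)
          = (if m = l then 1 else 0)" if "inj c" for c :: "'k \<Rightarrow> 'n"
        using k_regular_left_inverse_ac[OF assms(2) that] by simp
      show "(\<Sum>j\<in>UNIV. (\<chi> i j. to_ac (A $ i $ j)) $ i $ j * (x $ j) ^ d j) = 0"
        if "x \<in> S" for x i
      proof -
        have "eval_ac (f i) x = 0" using that S(1) by (auto simp: zero_locus_def)
        then show ?thesis
          using assms(5) by (simp add: eval_ac_sum eval_ac_pow_term)
      qed
    qed (use assms H S in auto)
  qed
  then show ?thesis by (auto simp: everywhere_finite_def)
qed

end
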